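(* Let $G$ be a finite simple graph and let $v$ be a splitting vertex of $G$ with $N(v)=\{v_1,\dots,v_d\}$. Set $J=(vv_1,\dots,vv_d)$ and $K=\mathcal{I}(G\setminus\{v\})$. Then $\mathcal{I}(G)=J+K$ is a splitting of $\mathcal{I}(G)$.
   Context: Graphs are undirected, without loops or multiple edges, not necessarily connected. The vertices of $G$ are identified with the variables of a polynomial ring $R=k[x_1,\dots,x_m]$ over a field $k$, and $\mathcal{I}(G)=(\{x_ix_j\mid\{x_i,x_j\}\in E_G\})\subseteq R$ is the edge ideal (edge ideals of subgraphs are viewed in $R$). $N(v)$ is the set of neighbors of $v$; $G\setminus\{v\}$ is $G$ with $v$ and all incident edges deleted. A vertex $v$ is a splitting vertex if $\deg v>0$ and $G\setminus\{v\}$ is not a graph consisting only of isolated vertices. $\mathcal{G}(I)$ is the minimal set of monomial generators of a monomial ideal $I$. An expression $I=J+K$ with $J,K$ nonzero monomial ideals is a splitting of $I$ if (1) $\mathcal{G}(I)$ is the disjoint union of $\mathcal{G}(J)$ and $\mathcal{G}(K)$, and (2) there is a function $\mathcal{G}(J\cap K)\to\mathcal{G}(J)\times\mathcal{G}(K)$, $w\mapsto(\phi(w),\psi(w))$, such that (a) $w=\mathrm{lcm}(\phi(w),\psi(w))$ for all $w\in\mathcal{G}(J\cap K)$, and (b) for every nonempty $S\subseteq\mathcal{G}(J\cap K)$, both $\mathrm{lcm}(\phi(S))$ and $\mathrm{lcm}(\psi(S))$ strictly divide $\mathrm{lcm}(S)$ (divide it and are not equal to it). *)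

theory Defs
  imports Complex_Main "HOL-Library.Poly_Mapping" "HOL-Library.Set_Algebras" "HOL-Library.FuncSet"
begin

text \<open>A commutative ring is a module over itself; its submodules are its ideals, so
  \<open>ideal.span S\<close> is the ideal generated by \<open>S\<close>.\<close>

interpretation ideal: module "(*) :: 'a::comm_ring_1 \<Rightarrow> 'a \<Rightarrow> 'a"
  by unfold_locales (simp_all add: algebra_simps)

text \<open>The polynomial ring over \<open>'k\<close> whose variables are the elements of \<open>'v\<close>: a polynomial is a
  finitely supported function from exponent vectors to coefficients.\<close>

type_synonym ('v, 'k) mpoly = "('v \<Rightarrow>\<^sub>0 nat) \<Rightarrow>\<^sub>0 'k"

definition var :: "'v \<Rightarrow> ('v, 'k::field) mpoly" where
  "var x = Poly_Mapping.single (Poly_Mapping.single x 1) 1"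

definition monomials :: "('v, 'k::field) mpoly set" where
  "monomials = range (\<lambda>a. Poly_Mapping.single a 1)"

definition monomial_ideal :: "('v, 'k::field) mpoly set \<Rightarrow> bool" where
  "monomial_ideal I \<longleftrightarrow> (\<exists>S\<subseteq>monomials. I = ideal.span S)"

definition is_min_monomial_gens ::
  "('v, 'k::field) mpoly set \<Rightarrow> ('v, 'k) mpoly set \<Rightarrow> bool" where
  "is_min_monomial_gens I S \<longleftrightarrow>
     S \<subseteq> monomials \<and> ideal.span S = I \<and> (\<forall>T. T \<subset> S \<longrightarrow> ideal.span T \<noteq> I)"

text \<open>For a monomial ideal this description is unique; see \<open>ex1_min_monomial_gens\<close>.\<close>

definition min_monomial_gens :: "('v, 'k::field) mpoly set \<Rightarrow> ('v, 'k) mpoly set" where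
  "min_monomial_gens I = (THE S. is_min_monomial_gens I S)"

definition is_monomial_lcm :: "('v, 'k::field) mpoly set \<Rightarrow> ('v, 'k) mpoly \<Rightarrow> bool" where
  "is_monomial_lcm S m \<longleftrightarrow> m \<in> monomials \<and> (\<forall>s\<in>S. s dvd m) \<and>
     (\<forall>n\<in>monomials. (\<forall>s\<in>S. s dvd n) \<longrightarrow> m dvd n)"

text \<open>Well defined for finite sets of monomials; see \<open>ex1_monomial_lcm\<close>.\<close>

definition monomial_lcm :: "('v, 'k::field) mpoly set \<Rightarrow> ('v, 'k) mpoly" where
  "monomial_lcm S = (THE m. is_monomial_lcm S m)"

definition strictly_divides :: "('v, 'k::field) mpoly \<Rightarrow> ('v, 'k) mpoly \<Rightarrow> bool" where
  "strictly_divides m n \<longleftrightarrow> m dvd n \<and> m \<noteq> n"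

text \<open>Here \<open>J + K\<close> is the elementwise sum of sets.\<close>

definition is_splitting ::
  "('v, 'k::field) mpoly set \<Rightarrow> ('v, 'k) mpoly set \<Rightarrow> ('v, 'k) mpoly set \<Rightarrow> bool" where
  "is_splitting I J K \<longleftrightarrow>
     monomial_ideal J \<and> monomial_ideal K \<and> J \<noteq> {0} \<and> K \<noteq> {0} \<and>
     I = J + K \<and>
     min_monomial_gens I = min_monomial_gens J \<union> min_monomial_gens K \<and>
     min_monomial_gens J \<inter> min_monomial_gens K = {} \<and>
     (\<exists>\<phi> \<psi>.
        \<phi> \<in> min_monomial_gens (J \<inter> K) \<rightarrow> min_monomial_gens J \<and>
        \<psi> \<in> min_monomial_gens (J \<inter> K) \<rightarrow> min_monomial_gens K \<and>
        (\<forall>w\<in>min_monomial_gens (J \<inter> K). w = monomial_lcm {\<phi> w, \<psi> w}) \<and>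
        (\<forall>S\<subseteq>min_monomial_gens (J \<inter> K). S \<noteq> {} \<longrightarrow>
           strictly_divides (monomial_lcm (\<phi> ` S)) (monomial_lcm S) \<and>
           strictly_divides (monomial_lcm (\<psi> ` S)) (monomial_lcm S)))"

record 'v ugraph =
  verts :: "'v set"
  edges :: "'v set set"

definition finite_simple_graph :: "'v ugraph \<Rightarrow> bool" where
  "finite_simple_graph G \<longleftrightarrow>
     finite (verts G) \<and> edges G \<subseteq> {e. e \<subseteq> verts G \<and> card e = 2}"

definition neighbors :: "'v ugraph \<Rightarrow> 'v \<Rightarrow> 'v set" where
  "neighbors G v = {u. {v, u} \<in> edges G}"

definition degree :: "'v ugraph \<Rightarrow> 'v \<Rightarrow> nat" where
  "degree G v = card {e \<in> edges G. v \<in> e}"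

definition delete_vertex :: "'v ugraph \<Rightarrow> 'v \<Rightarrow> 'v ugraph" where
  "delete_vertex G v = \<lparr>verts = verts G - {v}, edges = {e \<in> edges G. v \<notin> e}\<rparr>"

definition only_isolated_vertices :: "'v ugraph \<Rightarrow> bool" where
  "only_isolated_vertices G \<longleftrightarrow> (\<forall>u\<in>verts G. degree G u = 0)"

definition splitting_vertex :: "'v ugraph \<Rightarrow> 'v \<Rightarrow> bool" where
  "splitting_vertex G v \<longleftrightarrow>
     v \<in> verts G \<and> degree G v > 0 \<and> \<not> only_isolated_vertices (delete_vertex G v)"

text \<open>The ambient ring does not depend on \<open>verts G\<close>, so edge ideals of subgraphs live in the
  same ring.\<close>

definition edge_ideal :: "'v ugraph \<Rightarrow> ('v, 'k::field) mpoly set" where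
  "edge_ideal G = ideal.span {var x * var y | x y. {x, y} \<in> edges G}"

lemma monomial_dvd_iff:
  fixes a b :: "'v \<Rightarrow>\<^sub>0 nat"
  shows "(Poly_Mapping.single a 1 :: ('v, 'k::field) mpoly) dvd Poly_Mapping.single b 1 \<longleftrightarrow>
    (\<exists>c. b = a + c)"
proof
  assume "(Poly_Mapping.single a 1 :: ('v, 'k) mpoly) dvd Poly_Mapping.single b 1"
  then obtain q :: "('v, 'k) mpoly"
    where q: "Poly_Mapping.single b 1 = Poly_Mapping.single a 1 * q" by (elim dvdE)
  have "b \<in> Poly_Mapping.keys (Poly_Mapping.single a 1 * q)" by (simp flip: q)
  then show "\<exists>c. b = a + c" using keys_mult[of "Poly_Mapping.single a 1" q] by auto
next
  assume "\<exists>c. b = a + c"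
  then obtain c where "b = a + c" ..
  then have "(Poly_Mapping.single b 1 :: ('v, 'k) mpoly) =
      Poly_Mapping.single a 1 * Poly_Mapping.single c 1" by (simp add: mult_single)
  then show "(Poly_Mapping.single a 1 :: ('v, 'k) mpoly) dvd Poly_Mapping.single b 1" by simp
qed

lemma exponent_dvd_iff:
  fixes a b :: "'v \<Rightarrow>\<^sub>0 nat"
  shows "(\<exists>c. b = a + c) \<longleftrightarrow> (\<forall>x. Poly_Mapping.lookup a x \<le> Poly_Mapping.lookup b x)"
proof
  assume *: "\<forall>x. Poly_Mapping.lookup a x \<le> Poly_Mapping.lookup b x"
  have "b = a + (b - a)"
    by (rule poly_mapping_eqI) (simp add: lookup_add lookup_minus *)
  then show "\<exists>c. b = a + c" by blast
qed (auto simp: lookup_add)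

lemma monomial_dvd_antisym:
  fixes m n :: "('v, 'k::field) mpoly"
  assumes "m \<in> monomials" "n \<in> monomials" "m dvd n" "n dvd m"
  shows "m = n"
proof -
  obtain a b where ab: "m = Poly_Mapping.single a 1" "n = Poly_Mapping.single b 1"
    using assms by (auto simp: monomials_def)
  have "a = b"
    using assms(3,4) unfolding ab monomial_dvd_iff exponent_dvd_iff
    by (intro poly_mapping_eqI) (simp add: antisym)
  then show ?thesis by (simp add: ab)
qed

lemma ex1_monomial_lcm:
  fixes S :: "('v, 'k::field) mpoly set"
  assumes "finite S" "S \<subseteq> monomials"
  shows "\<exists>!m. is_monomial_lcm S m"
proof (rule ex_ex1I)
  show "\<exists>m. is_monomial_lcm S m" using assms
  proof (induction S rule: finite_induct)
    case empty
    have "is_monomial_lcm {} (1 :: ('v, 'k) mpoly)"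
      by (auto simp: is_monomial_lcm_def monomials_def image_def intro!: exI[of _ 0])
    then show ?case ..
  next
    case (insert s S)
    then obtain m where m: "is_monomial_lcm S m" by auto
    obtain a where a: "m = Poly_Mapping.single a 1"
      using m by (auto simp: is_monomial_lcm_def monomials_def)
    obtain b where b: "s = Poly_Mapping.single b 1"
      using insert.prems by (auto simp: monomials_def)
    define c where "c = a + (b - a)"
    have c: "Poly_Mapping.lookup c x = max (Poly_Mapping.lookup a x) (Poly_Mapping.lookup b x)" for x
      by (simp add: c_def lookup_add lookup_minus)
    have mc: "m dvd Poly_Mapping.single c 1" "s dvd Poly_Mapping.single c 1"
      by (simp_all only: a b monomial_dvd_iff exponent_dvd_iff c max.cobounded1 max.cobounded2
          simp_thms)
    have "Poly_Mapping.single c 1 dvd n" if n: "n \<in> monomials" "m dvd n" "s dvd n" for n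
    proof -
      obtain d where d: "n = Poly_Mapping.single d 1" using n(1) by (auto simp: monomials_def)
      show ?thesis using n(2,3) unfolding a b d monomial_dvd_iff exponent_dvd_iff c by auto
    qed
    then have "is_monomial_lcm (insert s S) (Poly_Mapping.single c 1)"
      using m mc unfolding is_monomial_lcm_def
      by (auto simp: monomials_def intro: dvd_trans)
    then show ?case ..
  qed
next
  show "m = n" if "is_monomial_lcm S m" "is_monomial_lcm S n" for m n
    using that monomial_dvd_antisym[of m n] unfolding is_monomial_lcm_def by blast
qed

lemma monomial_in_span:
  fixes S :: "('v, 'k::field) mpoly set"
  assumes S: "S \<subseteq> monomials" and m: "m \<in> monomials" "m \<in> ideal.span S"
  shows "\<exists>s\<in>S. s dvd m"
proof -
  define P where "P = (\<lambda>b. \<exists>s\<in>S. s dvd (Poly_Mapping.single b 1 :: ('v, 'k) mpoly))"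
  have mult: "P (c + b)" if "P b" for b c
  proof -
    have "(Poly_Mapping.single b 1 :: ('v, 'k) mpoly) dvd Poly_Mapping.single (c + b) 1"
      by (subst monomial_dvd_iff) (metis add.commute)
    then show ?thesis using that unfolding P_def by (blast intro: dvd_trans)
  qed
  have "ideal.subspace {p :: ('v, 'k) mpoly. \<forall>b\<in>Poly_Mapping.keys p. P b}"
  proof (rule ideal.subspaceI)
    fix p q :: "('v, 'k) mpoly"
    assume "p \<in> {p. \<forall>b\<in>Poly_Mapping.keys p. P b}" "q \<in> {p. \<forall>b\<in>Poly_Mapping.keys p. P b}"
    then show "p + q \<in> {p. \<forall>b\<in>Poly_Mapping.keys p. P b}" using keys_add[of p q] by auto
  next
    fix c p :: "('v, 'k) mpoly"
    assume "p \<in> {p. \<forall>b\<in>Poly_Mapping.keys p. P b}"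
    then show "c * p \<in> {p. \<forall>b\<in>Poly_Mapping.keys p. P b}" using keys_mult[of c p] mult by fastforce
  qed simp
  moreover have "S \<subseteq> {p. \<forall>b\<in>Poly_Mapping.keys p. P b}"
    using S by (force simp: monomials_def P_def)
  ultimately have "m \<in> {p. \<forall>b\<in>Poly_Mapping.keys p. P b}"
    using ideal.span_minimal m(2) by blast
  then show ?thesis using m(1) by (auto simp: monomials_def P_def)
qed

lemma dvd_in_span:
  fixes S :: "'a::comm_ring_1 set"
  assumes "s \<in> S" "s dvd m"
  shows "m \<in> ideal.span S"
  using assms ideal.span_scale[OF ideal.span_base[OF assms(1)]]
  by (metis dvdE mult.commute)

lemma ex1_min_monomial_gens:
  fixes I :: "('v::finite, 'k::field) mpoly set"
  assumes "monomial_ideal I"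
  shows "\<exists>!S. is_min_monomial_gens I S"
proof -
  obtain S where S: "S \<subseteq> monomials" "I = ideal.span S"
    using assms by (auto simp: monomial_ideal_def)
  define M where "M = {m\<in>S. \<forall>s\<in>S. s dvd m \<longrightarrow> s = m}"
  have below: "\<exists>m\<in>M. m dvd (Poly_Mapping.single a 1 :: ('v, 'k) mpoly)"
    if "Poly_Mapping.single a 1 \<in> S" for a
    using that
  proof (induction "\<Sum>x\<in>UNIV. Poly_Mapping.lookup a x" arbitrary: a rule: less_induct)
    case less
    show ?case
    proof (cases "Poly_Mapping.single a 1 \<in> M")
      case False
      then obtain s where s: "s \<in> S" "s dvd Poly_Mapping.single a 1" "s \<noteq> Poly_Mapping.single a 1"
        using less.prems by (auto simp: M_def)
      obtain b where b: "s = Poly_Mapping.single b 1" using s(1) S(1) by (auto simp: monomials_def)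
      have le: "\<forall>x. Poly_Mapping.lookup b x \<le> Poly_Mapping.lookup a x"
        using s(2) unfolding b monomial_dvd_iff exponent_dvd_iff .
      have "b \<noteq> a" using s(3) b by auto
      then obtain x where "Poly_Mapping.lookup b x \<noteq> Poly_Mapping.lookup a x"
        using poly_mapping_eqI[of b a] by auto
      then have "Poly_Mapping.lookup b x < Poly_Mapping.lookup a x"
        using le by (simp add: le_neq_implies_less)
      then have "(\<Sum>x\<in>UNIV. Poly_Mapping.lookup b x) < (\<Sum>x\<in>UNIV. Poly_Mapping.lookup a x)"
        using le by (intro sum_strict_mono_ex1) auto
      then show ?thesis using less.hyps[of b] s b dvd_trans by blast
    qed (blast intro: dvd_refl)
  qed
  have MS: "M \<subseteq> S" by (auto simp: M_def)
  have "S \<subseteq> ideal.span M"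
  proof
    fix s assume s: "s \<in> S"
    then obtain a where "s = Poly_Mapping.single a 1" using S(1) by (auto simp: monomials_def)
    then show "s \<in> ideal.span M" using below s dvd_in_span by blast
  qed
  then have span_M: "ideal.span M = I"
    unfolding S(2) using MS by (intro antisym ideal.span_mono ideal.span_minimal) auto
  have sub: "M \<subseteq> T" if T: "T \<subseteq> monomials" "ideal.span T = I" for T
  proof
    fix m assume m: "m \<in> M"
    then have mm: "m \<in> monomials" using MS S(1) by auto
    have "m \<in> ideal.span T" using m T(2) span_M ideal.span_base by blast
    then obtain t where t: "t \<in> T" "t dvd m" using monomial_in_span[OF T(1) mm] by auto
    have tm: "t \<in> monomials" using t T by auto
    have "t \<in> ideal.span S" using t(1) T(2) S(2) ideal.span_base by blast
    then obtain s where s: "s \<in> S" "s dvd t" using monomial_in_span[OF S(1) tm] by auto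
    then have "s = m" using m t(2) dvd_trans by (auto simp: M_def)
    then show "m \<in> T" using monomial_dvd_antisym[OF tm mm t(2)] s t by auto
  qed
  show ?thesis
  proof (rule ex1I)
    show "is_min_monomial_gens I M"
      using MS S(1) span_M sub unfolding is_min_monomial_gens_def by blast
    show "T = M" if "is_min_monomial_gens I T" for T
      using that sub[of T] span_M unfolding is_min_monomial_gens_def by blast
  qed
qed

end

theory Submission
  imports Defs
begin

text \<open>All monomials that occur are squarefree, so divisibility is inclusion of supports and lcm is
  union. A minimal generator \<open>w\<close> of \<open>J \<inter> K\<close> is the lcm of any edge at \<open>v\<close> and any edge avoiding \<open>v\<close>
  that divide it. Order the vertices so that the neighbours of \<open>v\<close> come first, and let \<open>\<phi> w = v u\<close>
  where \<open>u\<close> is the least vertex other than \<open>v\<close> in the support of \<open>w\<close>. Each support has at least two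
  vertices besides \<open>v\<close>, so the greatest vertex occurring in \<open>S\<close> is missing from \<open>lcm (\<phi> S)\<close>; and \<open>v\<close>
  is missing from \<open>lcm (\<psi> S)\<close>.\<close>

section \<open>Squarefree monomials: divisibility and lcm\<close>

text \<open>The product of the variables in \<open>A\<close>. For infinite \<open>A\<close> the sum
  defaults to 0 and the value is 1, hence the finiteness hypotheses below.\<close>

definition sqfree_monomial :: "'v set \<Rightarrow> ('v, 'k::field) mpoly" where
  "sqfree_monomial A = Poly_Mapping.single (\<Sum>x\<in>A. Poly_Mapping.single x 1) 1"

lemma lookup_sum_single:
  assumes "finite A"
  shows "Poly_Mapping.lookup (\<Sum>x\<in>A. Poly_Mapping.single x (1::nat)) z = (if z \<in> A then 1 else 0)"
  using assms
  by (induction A rule: finite_induct) (auto simp: lookup_add lookup_single when_def)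

lemma sqfree_monomial_in_monomials [simp]: "sqfree_monomial A \<in> monomials"
  by (simp add: sqfree_monomial_def monomials_def)

lemma sqfree_monomial_nonzero: "sqfree_monomial A \<noteq> 0"
  by (simp add: sqfree_monomial_def flip: keys_eq_empty)

text \<open>All exponents on the left are 0 or 1, so only positivity of \<open>b\<close> on
  \<open>A\<close> matters. The right side is an arbitrary monomial because the lcm is tested
  against all monomials, squarefree or not.\<close>

lemma sqfree_monomial_dvd_single:
  assumes "finite A"
  shows "(sqfree_monomial A :: ('v, 'k::field) mpoly) dvd Poly_Mapping.single b 1
    \<longleftrightarrow> A \<subseteq> Poly_Mapping.keys b"
  unfolding sqfree_monomial_def monomial_dvd_iff exponent_dvd_iff
  using lookup_sum_single[OF assms]
  by (auto simp: in_keys_iff Suc_le_eq split: if_splits)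

lemma sqfree_monomial_dvd_iff:
  assumes "finite A" "finite B"
  shows "(sqfree_monomial A :: ('v, 'k::field) mpoly) dvd sqfree_monomial B \<longleftrightarrow> A \<subseteq> B"
proof -
  have "Poly_Mapping.keys (\<Sum>x\<in>B. Poly_Mapping.single x (1::nat)) = B"
    using lookup_sum_single[OF assms(2)] by (auto simp: in_keys_iff split: if_splits)
  then show ?thesis
    unfolding sqfree_monomial_def[of B] by (simp add: sqfree_monomial_dvd_single[OF assms(1)])
qed

lemma sqfree_monomial_eq_iff:
  assumes "finite A" "finite B"
  shows "(sqfree_monomial A :: ('v, 'k::field) mpoly) = sqfree_monomial B \<longleftrightarrow> A = B"
  using sqfree_monomial_dvd_iff[OF assms, where 'k='k]
    sqfree_monomial_dvd_iff[OF assms(2,1), where 'k='k] by auto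

lemma var_mult_var:
  "x \<noteq> y \<Longrightarrow> (var x * var y :: ('v, 'k::field) mpoly) = sqfree_monomial {x, y}"
  by (simp add: var_def sqfree_monomial_def mult_single)

lemma monomial_lcm_eqI:
  assumes "is_monomial_lcm S m"
  shows "monomial_lcm S = m"
proof -
  have "n = m" if "is_monomial_lcm S n" for n
    using that assms monomial_dvd_antisym[of m n] unfolding is_monomial_lcm_def by blast
  with assms show ?thesis unfolding monomial_lcm_def by blast
qed

lemma monomial_lcm_sqfree:
  assumes "finite (\<Union>F)"
  shows "monomial_lcm (sqfree_monomial ` F :: ('v, 'k::field) mpoly set) = sqfree_monomial (\<Union>F)"
proof (rule monomial_lcm_eqI)
  have fin: "finite A" if "A \<in> F" for A
    using that assms by (meson Union_upper finite_subset)
  show "is_monomial_lcm (sqfree_monomial ` F :: ('v, 'k) mpoly set) (sqfree_monomial (\<Union>F))"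
    unfolding is_monomial_lcm_def monomials_def
    using fin assms
    by (auto simp: sqfree_monomial_dvd_single sqfree_monomial_dvd_iff)
      (auto simp: sqfree_monomial_def)
qed

section \<open>Monomial ideals, their intersections and minimal generators\<close>

text \<open>A polynomial is a linear combination of its monomials; conversely, every monomial
  occurring in a multiple of a generator is itself divisible by that generator.\<close>

lemma span_monomials_iff:
  fixes S :: "('v, 'k::field) mpoly set"
  assumes S: "S \<subseteq> monomials"
  shows "p \<in> ideal.span S \<longleftrightarrow>
    (\<forall>b\<in>Poly_Mapping.keys p. Poly_Mapping.single b 1 \<in> ideal.span S)"
proof
  assume *: "\<forall>b\<in>Poly_Mapping.keys p. Poly_Mapping.single b 1 \<in> ideal.span S"
  have "p = (\<Sum>b\<in>Poly_Mapping.keys p.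
      Poly_Mapping.single 0 (Poly_Mapping.lookup p b) * Poly_Mapping.single b 1)"
    by (rule poly_mapping_eqI) (auto simp: mult_single lookup_sum lookup_single when_def in_keys_iff)
  also have "\<dots> \<in> ideal.span S"
    using * by (intro ideal.span_sum ideal.span_scale) auto
  finally show "p \<in> ideal.span S" .
next
  assume "p \<in> ideal.span S"
  then show "\<forall>b\<in>Poly_Mapping.keys p. Poly_Mapping.single b 1 \<in> ideal.span S"
  proof (induction rule: ideal.span_induct_alt)
    case base
    show ?case by simp
  next
    case (step c x y)
    show ?case
    proof
      fix b assume "b \<in> Poly_Mapping.keys (c * x + y)"
      then consider "b \<in> Poly_Mapping.keys (c * x)" | "b \<in> Poly_Mapping.keys y"
        using keys_add[of "c * x" y] by blast
      then show "Poly_Mapping.single b 1 \<in> ideal.span S"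
      proof cases
        case 1
        obtain a where a: "x = Poly_Mapping.single a 1"
          using step(1) S by (auto simp: monomials_def)
        then obtain d where "b = d + a"
          using 1 keys_mult[of c x] by auto
        then have "x dvd Poly_Mapping.single b 1"
          unfolding a by (subst monomial_dvd_iff) (metis add.commute)
        then show ?thesis using step(1) dvd_in_span by blast
      qed (use step in blast)
    qed
  qed
qed

lemma monomial_ideal_span: "S \<subseteq> monomials \<Longrightarrow> monomial_ideal (ideal.span S)"
  unfolding monomial_ideal_def by blast

text \<open>Membership in each ideal is decided monomial by monomial, so the intersection is
  generated by the monomials it contains.\<close>

lemma monomial_ideal_Int:
  fixes I J :: "('v, 'k::field) mpoly set"
  assumes "monomial_ideal I" "monomial_ideal J"
  shows "monomial_ideal (I \<inter> J)"
proof -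
  obtain S T where ST: "S \<subseteq> monomials" "I = ideal.span S" "T \<subseteq> monomials" "J = ideal.span T"
    using assms unfolding monomial_ideal_def by blast
  have "ideal.span (monomials \<inter> (I \<inter> J)) \<subseteq> I \<inter> J"
    using ST by (intro ideal.span_minimal ideal.subspace_inter) auto
  moreover have "p \<in> ideal.span (monomials \<inter> (I \<inter> J))" if "p \<in> I \<inter> J" for p
  proof -
    have "Poly_Mapping.single b 1 \<in> ideal.span (monomials \<inter> (I \<inter> J))"
      if "b \<in> Poly_Mapping.keys p" for b
    proof (rule ideal.span_base)
      have "Poly_Mapping.single b 1 \<in> I" "Poly_Mapping.single b 1 \<in> J"
        using \<open>p \<in> I \<inter> J\<close> that span_monomials_iff[OF ST(1)] span_monomials_iff[OF ST(3)]
        unfolding ST(2,4) by blast+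
      then show "Poly_Mapping.single b 1 \<in> monomials \<inter> (I \<inter> J)"
        by (simp add: monomials_def)
    qed
    then show ?thesis by (subst span_monomials_iff) auto
  qed
  ultimately have "I \<inter> J = ideal.span (monomials \<inter> (I \<inter> J))" by blast
  then show ?thesis unfolding monomial_ideal_def by blast
qed

lemma is_min_monomial_gens_min_monomial_gens:
  fixes I :: "('v::finite, 'k::field) mpoly set"
  assumes "monomial_ideal I"
  shows "is_min_monomial_gens I (min_monomial_gens I)"
  unfolding min_monomial_gens_def by (rule theI'[OF ex1_min_monomial_gens[OF assms]])

text \<open>If a generator could be dropped, one of the remaining ones would divide it, which an
  antichain forbids.\<close>

lemma min_monomial_gens_span:
  fixes S :: "('v::finite, 'k::field) mpoly set"
  assumes S: "S \<subseteq> monomials"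
    and antichain: "\<And>s t. s \<in> S \<Longrightarrow> t \<in> S \<Longrightarrow> s dvd t \<Longrightarrow> s = t"
  shows "min_monomial_gens (ideal.span S) = S"
proof -
  have "ideal.span T \<noteq> ideal.span S" if T: "T \<subset> S" for T
  proof
    assume eq: "ideal.span T = ideal.span S"
    obtain s where s: "s \<in> S" "s \<notin> T" using T by blast
    have "T \<subseteq> monomials" "s \<in> monomials" "s \<in> ideal.span T"
      using T S s(1) ideal.span_base[OF s(1)] by (auto simp: eq)
    then obtain t where "t \<in> T" "t dvd s" using monomial_in_span by blast
    then show False using antichain[of t s] s T by blast
  qed
  then have "is_min_monomial_gens (ideal.span S) S"
    using S by (simp add: is_min_monomial_gens_def)
  then show ?thesis
    using is_min_monomial_gens_min_monomial_gens ex1_min_monomial_gens monomial_ideal_span[OF S]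
    by blast
qed

text \<open>For the last claim, \<open>m\<close> is a multiple of some minimal generator
  \<open>s\<close>, which then divides \<open>w\<close>. Were \<open>s\<close> different from
  \<open>w\<close>, then \<open>w\<close> would be redundant; so \<open>w\<close> divides
  \<open>m\<close> as well.\<close>

lemma min_monomial_gensD:
  fixes I :: "('v::finite, 'k::field) mpoly set"
  assumes I: "monomial_ideal I" and w: "w \<in> min_monomial_gens I"
  shows "w \<in> monomials" "w \<in> I"
    and "\<And>m. m \<in> monomials \<Longrightarrow> m \<in> I \<Longrightarrow> m dvd w \<Longrightarrow> m = w"
proof -
  let ?M = "min_monomial_gens I"
  have M: "?M \<subseteq> monomials" "ideal.span ?M = I" "\<And>T. T \<subset> ?M \<Longrightarrow> ideal.span T \<noteq> I"
    using is_min_monomial_gens_min_monomial_gens[OF I] by (auto simp: is_min_monomial_gens_def)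
  show mon: "w \<in> monomials" using M(1) w by blast
  show "w \<in> I" using M(2) w ideal.span_base by blast
  fix m assume m: "m \<in> monomials" "m \<in> I" "m dvd w"
  then obtain s where s: "s \<in> ?M" "s dvd m" using monomial_in_span[OF M(1)] M(2) by blast
  have "s = w"
  proof (rule ccontr)
    assume "s \<noteq> w"
    then have "w \<in> ideal.span (?M - {w})"
      using s m(3) by (intro dvd_in_span[of s]) (auto intro: dvd_trans)
    then have "?M \<subseteq> ideal.span (?M - {w})" using ideal.span_base[of _ "?M - {w}"] by auto
    then have "ideal.span (?M - {w}) = ideal.span ?M"
      by (intro antisym ideal.span_mono ideal.span_minimal) auto
    then show False using M(2) M(3)[of "?M - {w}"] w by blast
  qed
  then show "m = w" using monomial_dvd_antisym[OF m(1) mon m(3)] s by blast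
qed

text \<open>Finite sets of equal cardinality form an antichain under inclusion.\<close>

lemma min_monomial_gens_sqfree:
  fixes E :: "'v::finite set set"
  assumes "\<And>e. e \<in> E \<Longrightarrow> card e = n"
  shows "min_monomial_gens (ideal.span (sqfree_monomial ` E :: ('v, 'k::field) mpoly set)) =
    sqfree_monomial ` E"
proof (rule min_monomial_gens_span)
  show "sqfree_monomial ` E \<subseteq> monomials" by auto
  have eq: "a = b" if "a \<in> E" "b \<in> E" "a \<subseteq> b" for a b
    using card_subset_eq[OF finite that(3)] assms that(1,2) by simp
  show "s = t"
    if "s \<in> sqfree_monomial ` E" "t \<in> sqfree_monomial ` E" "s dvd t" for s t :: "('v, 'k) mpoly"
    using that eq by (auto simp: sqfree_monomial_dvd_iff) metis
qed

text \<open>\<open>w\<close> is a multiple of a generator of each ideal, hence of their lcm, which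
  already lies in the intersection; minimality gives equality. The last conclusion is minimality of
  the support, used later to exchange one edge at \<open>v\<close> for another.\<close>

lemma min_monomial_gens_Int_sqfree:
  fixes A B :: "'v::finite set set"
  defines "L \<equiv> ideal.span (sqfree_monomial ` A) \<inter>
    ideal.span (sqfree_monomial ` B :: ('v, 'k::field) mpoly set)"
  assumes w: "w \<in> min_monomial_gens L"
  obtains a b where "a \<in> A" "b \<in> B" "w = sqfree_monomial (a \<union> b)"
    "\<And>a' b'. a' \<in> A \<Longrightarrow> b' \<in> B \<Longrightarrow> a' \<union> b' \<subseteq> a \<union> b \<Longrightarrow> a' \<union> b' = a \<union> b"
proof -
  have mons: "sqfree_monomial ` C \<subseteq> (monomials :: ('v, 'k) mpoly set)" for C by auto
  have L: "monomial_ideal L"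
    unfolding L_def by (intro monomial_ideal_Int monomial_ideal_span mons)
  note D = min_monomial_gensD[OF L w]
  have inL: "sqfree_monomial (a \<union> b) \<in> L" if "a \<in> A" "b \<in> B" for a b
    unfolding L_def
    using that by (auto intro!: dvd_in_span[OF imageI] simp: sqfree_monomial_dvd_iff)
  obtain a b where ab: "a \<in> A" "b \<in> B" "sqfree_monomial a dvd w" "sqfree_monomial b dvd w"
    using D(2) monomial_in_span[OF mons D(1)] unfolding L_def by blast
  \<comment> \<open>The exponents of \<open>w\<close> are still unknown here: the two divisibilities
    only place \<open>a\<close> and \<open>b\<close> inside its support.\<close>
  have "sqfree_monomial (a \<union> b) dvd w"
    using D(1) ab(3,4) by (auto simp: monomials_def sqfree_monomial_dvd_single)
  then have w_eq: "sqfree_monomial (a \<union> b) = w"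
    using ab by (intro D(3) inL) auto
  moreover have "a' \<union> b' = a \<union> b" if "a' \<in> A" "b' \<in> B" "a' \<union> b' \<subseteq> a \<union> b" for a' b'
  proof -
    have "sqfree_monomial (a' \<union> b') = w"
      using that inL by (intro D(3)) (auto simp: sqfree_monomial_dvd_iff simp flip: w_eq)
    then show ?thesis by (simp add: sqfree_monomial_eq_iff flip: w_eq)
  qed
  ultimately show ?thesis using that ab by metis
qed

section \<open>A vertex ranking, and edges as squarefree monomials\<close>

text \<open>Take an injection into the numbers below \<open>n\<close> and shift its values outside
  \<open>N\<close> by \<open>n\<close>.\<close>

lemma ex_inj_rank_initial:
  fixes N :: "'v::finite set"
  obtains r :: "'v \<Rightarrow> nat" where "inj r" "\<And>x y. x \<in> N \<Longrightarrow> y \<notin> N \<Longrightarrow> r x < r y"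
proof -
  obtain f :: "'v \<Rightarrow> nat" and n where f: "f ` UNIV = {i. i < n}" "inj f"
    using finite_imp_inj_to_nat_seg[OF finite_class.finite_UNIV] by metis
  then have less: "f x < n" for x by blast
  show ?thesis
  proof
    have ne: "f x \<noteq> n + f y" for x y using less[of x] by simp
    show "inj (\<lambda>x. if x \<in> N then f x else n + f x)"
      by (rule injI) (auto simp: inj_eq[OF f(2)] ne ne[symmetric] split: if_splits)
    show "(if x \<in> N then f x else n + f x) < (if y \<in> N then f y else n + f y)"
      if "x \<in> N" "y \<notin> N" for x y
      using that less[of x] by simp
  qed
qed

text \<open>Cardinality 2 excludes \<open>x = y\<close>, where the product would be a
  square.\<close>

lemma edge_monomials_eq:
  assumes "\<And>e. e \<in> E \<Longrightarrow> card e = 2"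
  shows "{var x * var y | x y. {x, y} \<in> E} = (sqfree_monomial ` E :: ('v, 'k::field) mpoly set)"
proof -
  have "var x * var y \<in> (sqfree_monomial ` E :: ('v, 'k) mpoly set)" if "{x, y} \<in> E" for x y
  proof -
    have "x \<noteq> y" using assms[OF that] by auto
    then show ?thesis unfolding var_mult_var[OF \<open>x \<noteq> y\<close>] using that by (intro imageI)
  qed
  moreover have "(sqfree_monomial e :: ('v, 'k) mpoly) \<in> {var x * var y | x y. {x, y} \<in> E}"
    if e: "e \<in> E" for e
  proof -
    obtain x y where xy: "e = {x, y}" "x \<noteq> y" using assms[OF e] card_2_iff by metis
    have "(sqfree_monomial e :: ('v, 'k) mpoly) = var x * var y"
      unfolding xy(1) by (rule var_mult_var[OF xy(2), symmetric])
    then show ?thesis using e xy(1) by blast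
  qed
  ultimately show ?thesis by (intro antisym subsetI) (force, force)
qed

section \<open>The splitting at \<open>v\<close>\<close>

theorem theorem4p2:
  fixes G :: "'v::finite ugraph" and v :: 'v
    and J K :: "('v, 'k::field) mpoly set"
  assumes "finite_simple_graph G" and "verts G = UNIV"
    and "splitting_vertex G v"
    and "J = ideal.span {var v * var u | u. u \<in> neighbors G v}"
    and "K = edge_ideal (delete_vertex G v)"
  shows "is_splitting (edge_ideal G) J K"
proof -
  define A where "A = {e \<in> edges G. v \<in> e}"
  define B where "B = {e \<in> edges G. v \<notin> e}"
  have card2: "card e = 2" if "e \<in> edges G" for e
    using assms(1) that by (auto simp: finite_simple_graph_def)
  have E: "edges G = A \<union> B" and disj: "A \<inter> B = {}" by (auto simp: A_def B_def)
  have cardA: "card e = 2" if "e \<in> A" for e using card2 that E by blast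
  have cardB: "card e = 2" if "e \<in> B" for e using card2 that E by blast
  have A_ex: "\<exists>u. u \<noteq> v \<and> e = {v, u}" if "e \<in> A" for e
    using cardA[OF that] that by (auto simp: A_def card_2_iff doubleton_eq_iff)
  have I_eq: "edge_ideal G = ideal.span (sqfree_monomial ` (A \<union> B) :: ('v, 'k) mpoly set)"
    unfolding edge_ideal_def by (subst edge_monomials_eq[OF card2]) (simp_all add: E)
  have K_eq: "K = ideal.span (sqfree_monomial ` B)"
    using edge_monomials_eq[of B, OF cardB, where 'k='k]
    by (simp add: assms(5) edge_ideal_def delete_vertex_def B_def)
  have "{var v * var u | u. u \<in> neighbors G v} = (sqfree_monomial ` A :: ('v, 'k) mpoly set)"
  proof -
    have A_eq: "A = (\<lambda>u. {v, u}) ` neighbors G v"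
      using A_ex by (auto simp: neighbors_def A_def)
    have "u \<noteq> v" if "u \<in> neighbors G v" for u
      using card2[of "{v, u}"] that by (auto simp: neighbors_def)
    then have "(sqfree_monomial {v, u} :: ('v, 'k) mpoly) = var v * var u"
      if "u \<in> neighbors G v" for u
      using that by (subst var_mult_var) auto
    then show ?thesis
      unfolding A_eq image_image setcompr_eq_image by (simp cong: image_cong)
  qed
  then have J_eq: "J = ideal.span (sqfree_monomial ` A)" by (simp add: assms(4))
  have "A \<noteq> {}"
    using assms(3) by (auto simp: splitting_vertex_def degree_def A_def card_gt_0_iff)
  have "B \<noteq> {}"
    using assms(3) by (auto simp: splitting_vertex_def only_isolated_vertices_def degree_def
        delete_vertex_def B_def card_gt_0_iff)
  have ne0: "ideal.span (sqfree_monomial ` C :: ('v, 'k) mpoly set) \<noteq> {0}" if "C \<noteq> {}" for C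
    using that ideal.span_base[of _ "sqfree_monomial ` C :: ('v, 'k) mpoly set"]
      sqfree_monomial_nonzero by fastforce
  have gensA: "min_monomial_gens J = sqfree_monomial ` A"
    unfolding J_eq by (rule min_monomial_gens_sqfree[OF cardA])
  have gensB: "min_monomial_gens K = sqfree_monomial ` B"
    unfolding K_eq by (rule min_monomial_gens_sqfree[OF cardB])
  have gensAB: "min_monomial_gens (edge_ideal G :: ('v, 'k) mpoly set) = sqfree_monomial ` (A \<union> B)"
    unfolding I_eq by (rule min_monomial_gens_sqfree[where n = 2]) (use cardA cardB in auto)

  obtain r :: "'v \<Rightarrow> nat" where r: "inj r"
    and r_less: "\<And>x y. {v, x} \<in> A \<Longrightarrow> {v, y} \<notin> A \<Longrightarrow> r x < r y"
    using ex_inj_rank_initial[of "{u. {v, u} \<in> A}"] by auto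
  let ?W = "min_monomial_gens (J \<inter> K)"
  \<comment> \<open>The edge \<open>b\<close> is kept from some decomposition of \<open>w\<close>;
    only the edge at \<open>v\<close> is exchanged. Of the minimality of \<open>u\<close>, just the
    comparison with the vertices of \<open>b\<close> is recorded.\<close>
  have "\<exists>u b. {v, u} \<in> A \<and> b \<in> B \<and> w = sqfree_monomial ({v, u} \<union> b) \<and> (\<forall>y\<in>b. r u \<le> r y)"
    if w: "w \<in> ?W" for w
  proof -
    obtain a b where ab: "a \<in> A" "b \<in> B" "w = sqfree_monomial (a \<union> b)"
      and min: "\<And>a' b'. a' \<in> A \<Longrightarrow> b' \<in> B \<Longrightarrow> a' \<union> b' \<subseteq> a \<union> b \<Longrightarrow> a' \<union> b' = a \<union> b"
      using min_monomial_gens_Int_sqfree[OF w[unfolded J_eq K_eq]] by blast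
    obtain x where x: "x \<noteq> v" "a = {v, x}" using A_ex[OF ab(1)] by blast
    define u where "u = arg_min_on r (a \<union> b - {v})"
    have ne: "a \<union> b - {v} \<noteq> {}" using x by auto
    have u: "u \<in> a \<union> b - {v}" unfolding u_def by (rule arg_min_if_finite(1)[OF finite ne])
    have least: "r u \<le> r y" if "y \<in> a \<union> b - {v}" for y
      unfolding u_def by (rule arg_min_least[OF finite ne that])
    \<comment> \<open>The neighbour \<open>x\<close> of \<open>v\<close> competes in the minimum. If
      \<open>u\<close> were not a neighbour, then \<open>r x < r u\<close>, against the choice of
      \<open>u\<close>.\<close>
    have uA: "{v, u} \<in> A"
      using r_less[of x u] least[of x] ab(1) x by fastforce
    \<comment> \<open>The left side is contained in the support of \<open>w\<close>, and minimality
      of that support forces equality.\<close>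
    moreover have "{v, u} \<union> b = a \<union> b"
      using uA ab u x by (intro min) auto
    moreover have "v \<notin> b" using ab(2) by (simp add: B_def)
    ultimately show ?thesis
      using ab least by (intro exI[of _ u] exI[of _ b]) auto
  qed
  then obtain u b where uA: "\<And>w. w \<in> ?W \<Longrightarrow> {v, u w} \<in> A"
    and bB: "\<And>w. w \<in> ?W \<Longrightarrow> b w \<in> B"
    and w_eq: "\<And>w. w \<in> ?W \<Longrightarrow> w = sqfree_monomial ({v, u w} \<union> b w)"
    and least: "\<And>w y. w \<in> ?W \<Longrightarrow> y \<in> b w \<Longrightarrow> r (u w) \<le> r y"
    by metis
  define \<phi> where "\<phi> w = (sqfree_monomial {v, u w} :: ('v, 'k) mpoly)" for w
  define \<psi> where "\<psi> w = (sqfree_monomial (b w) :: ('v, 'k) mpoly)" for w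
  have "w = monomial_lcm {\<phi> w, \<psi> w}" if "w \<in> ?W" for w
    using w_eq[OF that] monomial_lcm_sqfree[of "{{v, u w}, b w}", where 'k='k]
    by (simp add: \<phi>_def \<psi>_def)
  moreover have "strictly_divides (monomial_lcm (\<phi> ` S)) (monomial_lcm S) \<and>
      strictly_divides (monomial_lcm (\<psi> ` S)) (monomial_lcm S)"
    if S: "S \<subseteq> ?W" "S \<noteq> {}" for S
  proof -
    \<comment> \<open>\<open>P\<close> and \<open>Q\<close> are the supports of the lcms of
      \<open>\<phi>\<close> S\<open>and\<close>\<psi> \<open>S\<close>. Strictness then amounts to
      two facts: \<open>Q\<close> is not contained in \<open>P\<close>, and \<open>v\<close> lies in
      \<open>P\<close> but not in \<open>Q\<close>.\<close>
    define P where "P = (\<Union>w\<in>S. {v, u w})"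
    define Q where "Q = (\<Union>w\<in>S. b w)"
    have "S = sqfree_monomial ` (\<lambda>w. {v, u w} \<union> b w) ` S"
      unfolding image_image using w_eq S(1) by force
    then have "monomial_lcm S = sqfree_monomial (\<Union>((\<lambda>w. {v, u w} \<union> b w) ` S))"
      using monomial_lcm_sqfree[OF finite] by metis
    also have "\<Union>((\<lambda>w. {v, u w} \<union> b w) ` S) = P \<union> Q"
      by (auto simp: P_def Q_def)
    finally have lcm_S: "monomial_lcm S = sqfree_monomial (P \<union> Q)" .
    have lcm_\<phi>: "monomial_lcm (\<phi> ` S) = sqfree_monomial P"
      using monomial_lcm_sqfree[of "(\<lambda>w. {v, u w}) ` S", where 'k='k]
      by (simp add: \<phi>_def P_def image_image cong: image_cong)
    have lcm_\<psi>: "monomial_lcm (\<psi> ` S) = sqfree_monomial Q"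
      using monomial_lcm_sqfree[of "b ` S", where 'k='k]
      by (simp add: \<psi>_def Q_def image_image cong: image_cong)
    have vP: "v \<in> P" using S(2) by (auto simp: P_def)
    have vQ: "v \<notin> Q" using bB S(1) by (auto simp: Q_def B_def)
    have "\<not> Q \<subseteq> P"
    proof
      assume QP: "Q \<subseteq> P"
      have b_ex: "\<exists>y\<in>b w. y \<noteq> u w" if "w \<in> S" for w
      proof (rule ccontr)
        assume "\<not> ?thesis"
        then have "card (b w) \<le> card {u w}" by (intro card_mono) auto
        then show False using cardB[OF bB[of w]] that S(1) by auto
      qed
      have "Q \<noteq> {}" using b_ex S(2) by (auto simp: Q_def)
      \<comment> \<open>The vertex of \<open>Q\<close> of greatest rank, obtained by minimizing the
        negated rank in \<open>int\<close>.\<close>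
      define z where "z = arg_min_on (\<lambda>y. - int (r y)) Q"
      have zQ: "z \<in> Q" unfolding z_def by (rule arg_min_if_finite(1)[OF finite \<open>Q \<noteq> {}\<close>])
      have z_max: "r y \<le> r z" if "y \<in> Q" for y
        using arg_min_least[OF finite \<open>Q \<noteq> {}\<close> that, of "\<lambda>y. - int (r y)"] by (simp add: z_def)
      \<comment> \<open>By assumption \<open>z\<close> lies in \<open>P\<close>, and it differs from
        \<open>v\<close> because \<open>v\<close> is not in \<open>Q\<close>; so it is one of the
        chosen vertices \<open>u w\<close>.\<close>
      obtain w where w: "w \<in> S" "z = u w" using zQ QP vQ unfolding P_def by blast
      obtain y where y: "y \<in> b w" "y \<noteq> u w" using b_ex[OF w(1)] by blast
      have "y \<in> Q" using w(1) y(1) unfolding Q_def by blast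
      moreover have "w \<in> ?W" using w(1) S(1) by blast
      \<comment> \<open>The rank of \<open>y\<close> is squeezed: at least that of
        \<open>u w\<close> by the choice of \<open>u w\<close>, at most that of
        \<open>z = u w\<close> by maximality. Injectivity of \<open>r\<close> then contradicts
        \<open>y \<noteq> u w\<close>.\<close>
      ultimately have "r y = r (u w)"
        using least[of w y] z_max[of y] w(2) y(1) by simp
      then show False using r y(2) by (simp add: inj_eq)
    qed
    then show ?thesis
      unfolding lcm_S lcm_\<phi> lcm_\<psi> strictly_divides_def
      using vP vQ by (auto simp: sqfree_monomial_dvd_iff sqfree_monomial_eq_iff)
  qed
  moreover have "\<phi> \<in> ?W \<rightarrow> min_monomial_gens J" "\<psi> \<in> ?W \<rightarrow> min_monomial_gens K"
    using uA bB by (auto simp: \<phi>_def \<psi>_def gensA gensB)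
  moreover have "edge_ideal G = J + K"
    unfolding I_eq J_eq K_eq image_Un ideal.span_Un by (auto simp: set_plus_def)
  moreover have "monomial_ideal J" "monomial_ideal K"
    unfolding J_eq K_eq by (auto intro!: monomial_ideal_span)
  moreover have "min_monomial_gens J \<inter> min_monomial_gens K = {}"
    using disj by (auto simp: gensA gensB sqfree_monomial_eq_iff)
  moreover have "min_monomial_gens (edge_ideal G) = min_monomial_gens J \<union> min_monomial_gens K"
    by (simp add: gensA gensB gensAB image_Un)
  moreover have "J \<noteq> {0}" "K \<noteq> {0}"
    using ne0 \<open>A \<noteq> {}\<close> \<open>B \<noteq> {}\<close> by (simp_all add: J_eq K_eq)
  ultimately show ?thesis unfolding is_splitting_def by blast
qed

end
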